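(* If $P$ is a natural unit interval order, then the statistic $\mathrm{asc}$ is constant on connected components of the $P$-array crystal $(\mathcal A_P,e_r,f_r,\mathbf{wt})$.
   Context: A natural unit interval order is a finite poset $(P,\le_P)$ on a subset of $\mathbb N$ such that (i) $u<_Pv$ implies $u<v$ as natural numbers, and (ii) if $u<_Pw$ with $v\parallel w$ and $v\parallel u$, then $u<v<w$ as natural numbers. Here $u\parallel v$ means $u,v$ are incomparable in $P$. Such posets are (3+1)-free (they contain no induced disjoint union of a 3-element chain and a 1-element chain), and the constructions below apply to finite (3+1)-free posets. $\mathbb Z_+$ is the set of positive integers. $P$-arrays. A $P$-array is an indexing $A=\{A_{i,j}\}$ of the elements of $P$ (each element of $P$ occurs exactly once) by positions $(i,j)\in\mathbb Z_+\times\mathbb Z_+$ such that if $A_{i,j}$ is defined with $j>1$ then $A_{i,j-1}$ is defined and $A_{i,j-1}<_P A_{i,j}$. So a $P$-array amounts to an assignment of the elements of $P$ to rows indexed by $\mathbb Z_+$, each row being a chain listed in increasing order. $\mathcal A_P$ is the set of $P$-arrays. The weight $\mathbf{wt}(A)$ is the sequence whose $i$th entry is the number of elements in row $i$. For $A\in\mathcal A_P$, $\mathrm{asc}(A)$ is the number of pairs $(x,y)\in P\times P$ such that $x\parallel y$, $x<y$ as natural numbers, and $x$ lies in a higher row of $A$ than $y$ (i.e. the row index of $x$ is smaller than that of $y$). The $r$ alignment. Let $A$ be a $P$-array, $r\ge1$, and let $a_1<_P\cdots<_Pa_m$ and $b_1<_P\cdots<_Pb_n$ be the elements of rows $r$ and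 $r+1$ of $A$. Define $C(b_k)=k$ and, inductively, $C(a_k)=\max(\{C(b_i)\mid b_i<_Pa_k\}\cup\{C(a_i)\mid 1\le i<k\})+1$ (with $\max\emptyset=0$). The $r$ pre-alignment $\phi_0:\{a_1,\dots,a_m,b_1,\dots,b_n\}\to\{r,r+1\}\times\mathbb Z_+$ sends $a_k\mapsto(r,C(a_k))$ and $b_k\mapsto(r+1,C(b_k))$; the second coordinate is called the column. Given $\phi_k$, select the rightmost element $x$, say mapped to $(i,c)$, such that column $c+1$ of $\phi_k$ is nonempty and contains no $y>_Px$, if such $x$ exists; then $\phi_{k+1}(x)=(i,c+1)$ and $\phi_{k+1}=\phi_k$ elsewhere. If no such $x$ exists, $\phi_k$ is the $r$ alignment of $A$. Operators $f_r,e_r:\mathcal A_P\to\mathcal A_P\cup\{0\}$ ($r\ge 1$), where, for $A\in\mathcal A_P$, $a_1<_P\cdots<_Pa_m$ and $b_1<_P\cdots<_Pb_n$ are the elements of rows $r$ and $r+1$ of $A$, and "column" means column in the $r$ alignment of $A$. Lowering: if every column with an entry in row $r$ also contains an entry in row $r+1$, then $f_r(A)=0$. Otherwise let $p$ be minimal such that $a_p$ does not share a column with an element of row $r+1$, and let $t\ge0$ be minimal such that there is no $b_i\not>_Pa_{p+t}$ one column right of $a_{p+t}$. Then $f_r(A)$ is obtained from $A$ by moving $a_p,\dots,a_{p+t}$ to row $r+1$ and any $b_i$ that shares a column with one of these entries to row $r$. Raising: if every column with an entry in row $r+1$ also contains an entry in row $r$, then $e_r(A)=0$. Otherwise let $p$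 be maximal such that $b_p$ does not share a column with an entry of row $r$, and let $t\ge0$ be minimal such that there is no $a_i\not>_Pb_{p+t}$ one column right of $b_{p+t}$. Then $e_r(A)$ is obtained from $A$ by moving $b_p,\dots,b_{p+t}$ to row $r$ and any $a_i$ that shares a column with one of these entries to row $r+1$. The $P$-array crystal is the directed colored graph with vertex set $\mathcal A_P$ and an edge of color $r$ from $A$ to $f_r(A)$ whenever $f_r(A)\neq0$ (equivalently, from $e_r(A)$ to $A$ whenever $e_r(A)\ne0$). Connected components are those of the underlying undirected graph. *)

theory Defs
  imports Main
begin

section \<open>Natural unit interval orders\<close>

definition less_P :: "nat rel \<Rightarrow> nat \<Rightarrow> nat \<Rightarrow> bool" where
  "less_P le x y \<longleftrightarrow> (x, y) \<in> le \<and> x \<noteq> y"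

definition incomparable :: "nat rel \<Rightarrow> nat \<Rightarrow> nat \<Rightarrow> bool" where
  "incomparable le x y \<longleftrightarrow> (x, y) \<notin> le \<and> (y, x) \<notin> le"

definition natural_unit_interval_order :: "nat set \<Rightarrow> nat rel \<Rightarrow> bool" where
  "natural_unit_interval_order P le \<longleftrightarrow>
     finite P \<and> partial_order_on P le \<and>
     (\<forall>u\<in>P. \<forall>v\<in>P. less_P le u v \<longrightarrow> u < v) \<and>
     (\<forall>u\<in>P. \<forall>v\<in>P. \<forall>w\<in>P.
        less_P le u w \<and> incomparable le v w \<and> incomparable le v u \<longrightarrow> u < v \<and> v < w)"

section \<open>\<open>P\<close>-arrays\<close>

text \<open>
  An array is given by its rows: \<open>A i\<close> is the list of the entries of row \<open>i\<close>, so that the entry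
  in position \<open>(i, j)\<close>, with \<open>i\<close> and \<open>j\<close> positive, is \<open>A i ! (j - 1)\<close>, defined for
  \<open>j \<le> length (A i)\<close>. Rows are indexed by the positive integers; row \<open>0\<close> is a dummy, kept empty.
\<close>

type_synonym array = "nat \<Rightarrow> nat list"

definition P_arrays :: "nat set \<Rightarrow> nat rel \<Rightarrow> array set" where
  "P_arrays P le =
     {A. A 0 = [] \<and>
         (\<forall>i. set (A i) \<subseteq> P) \<and>
         (\<forall>x\<in>P. \<exists>!(i, j). j < length (A i) \<and> A i ! j = x) \<and>
         (\<forall>i j. Suc j < length (A i) \<longrightarrow> less_P le (A i ! j) (A i ! Suc j))}"

definition asc :: "nat set \<Rightarrow> nat rel \<Rightarrow> array \<Rightarrow> nat" where
  "asc P le A =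
     card {(x, y) \<in> P \<times> P. incomparable le x y \<and> x < y \<and>
             (\<exists>i j. x \<in> set (A i) \<and> y \<in> set (A j) \<and> i < j)}"

section \<open>The \<open>r\<close> alignment\<close>

text \<open>
  \<open>col_a le as bs k\<close> is the column $C(a_{k+1})$ for the 0-based index \<open>k\<close>, where \<open>as\<close> and \<open>bs\<close>
  list rows \<open>r\<close> and \<open>r + 1\<close>; \<open>bs ! i\<close> is in column \<open>Suc i\<close>. Inserting \<open>0\<close> only serves to make the
  maximum of the empty set \<open>0\<close>, as columns are positive.
\<close>

fun col_a :: "nat rel \<Rightarrow> nat list \<Rightarrow> nat list \<Rightarrow> nat \<Rightarrow> nat" where
  "col_a le as bs k =
     Max (insert 0 ({Suc i | i. i < length bs \<and> less_P le (bs ! i) (as ! k)} \<union>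
                    col_a le as bs ` {..<k})) + 1"

declare col_a.simps [simp del]

definition index_in :: "nat list \<Rightarrow> nat \<Rightarrow> nat" where
  "index_in xs x = (THE k. k < length xs \<and> xs ! k = x)"

text \<open>
  The maps $\phi_k$ never change the row of an element, so only columns are recorded. The value
  outside of rows \<open>r\<close> and \<open>r + 1\<close> is irrelevant.
\<close>

definition pre_alignment :: "nat rel \<Rightarrow> nat \<Rightarrow> array \<Rightarrow> nat \<Rightarrow> nat" where
  "pre_alignment le r A x =
     (if x \<in> set (A r) then col_a le (A r) (A (Suc r)) (index_in (A r) x)
      else Suc (index_in (A (Suc r)) x))"

definition movable :: "nat rel \<Rightarrow> nat set \<Rightarrow> (nat \<Rightarrow> nat) \<Rightarrow> nat \<Rightarrow> bool" where
  "movable le X \<phi> x \<longleftrightarrow>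
     x \<in> X \<and> (\<exists>y\<in>X. \<phi> y = \<phi> x + 1) \<and> \<not> (\<exists>y\<in>X. \<phi> y = \<phi> x + 1 \<and> less_P le x y)"

text \<open>
  The rightmost movable element is unique: columns increase strictly along each row, so a movable
  element of column \<open>c\<close> has no entry of its own row in column \<open>c + 1\<close>. Were column \<open>c\<close> to have a
  movable element in both rows, column \<open>c + 1\<close> would be empty.
\<close>

definition align_step :: "nat rel \<Rightarrow> nat set \<Rightarrow> (nat \<Rightarrow> nat) \<Rightarrow> (nat \<Rightarrow> nat)" where
  "align_step le X \<phi> =
     (let x = (ARG_MAX \<phi> x. movable le X \<phi> x) in \<phi>(x := \<phi> x + 1))"

definition align_seq :: "nat rel \<Rightarrow> nat \<Rightarrow> array \<Rightarrow> nat \<Rightarrow> (nat \<Rightarrow> nat)" where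
  "align_seq le r A k =
     (align_step le (set (A r) \<union> set (A (Suc r))) ^^ k) (pre_alignment le r A)"

definition alignment :: "nat rel \<Rightarrow> nat \<Rightarrow> array \<Rightarrow> (nat \<Rightarrow> nat)" where
  "alignment le r A =
     align_seq le r A
       (LEAST k. \<not> (\<exists>x. movable le (set (A r) \<union> set (A (Suc r))) (align_seq le r A k) x))"

section \<open>The operators and the crystal\<close>

text \<open>
  \<open>None\<close> stands for $0$. The indices \<open>p\<close> and \<open>p + t\<close> are 0-based positions in a row. A chain of
  \<open>P\<close> in increasing order is also increasing for the order of the natural numbers, so
  \<open>sorted_list_of_set\<close> lists a row correctly.
\<close>

definition lower :: "nat rel \<Rightarrow> nat \<Rightarrow> array \<Rightarrow> array option" where
  "lower le r A =
     (let as = A r; bs = A (Suc r); col = alignment le r A in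
      if \<forall>a\<in>set as. \<exists>b\<in>set bs. col b = col a then None
      else
        let p = (LEAST p. p < length as \<and> \<not> (\<exists>b\<in>set bs. col b = col (as ! p)));
            t = (LEAST t. p + t < length as \<and>
                   \<not> (\<exists>b\<in>set bs. \<not> less_P le (as ! (p + t)) b \<and> col b = col (as ! (p + t)) + 1));
            S = {as ! i | i. p \<le> i \<and> i \<le> p + t};
            T = {b \<in> set bs. \<exists>a\<in>S. col b = col a}
        in Some (A(r := sorted_list_of_set (set as - S \<union> T),
                   Suc r := sorted_list_of_set (set bs - T \<union> S))))"

definition raise :: "nat rel \<Rightarrow> nat \<Rightarrow> array \<Rightarrow> array option" where
  "raise le r A =
     (let as = A r; bs = A (Suc r); col = alignment le r A in
      if \<forall>b\<in>set bs. \<exists>a\<in>set as. col a = col b then None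
      else
        let p = (GREATEST p. p < length bs \<and> \<not> (\<exists>a\<in>set as. col a = col (bs ! p)));
            t = (LEAST t. p + t < length bs \<and>
                   \<not> (\<exists>a\<in>set as. \<not> less_P le (bs ! (p + t)) a \<and> col a = col (bs ! (p + t)) + 1));
            S = {bs ! i | i. p \<le> i \<and> i \<le> p + t};
            T = {a \<in> set as. \<exists>b\<in>S. col a = col b}
        in Some (A(r := sorted_list_of_set (set as - T \<union> S),
                   Suc r := sorted_list_of_set (set bs - S \<union> T))))"

text \<open>
  Edges of color \<open>r\<close>: from \<open>A\<close> to $f_r(A)$ and from $e_r(A)$ to \<open>A\<close>, for \<open>A\<close> a \<open>P\<close>-array. As
  $e_r$ and $f_r$ are mutually inverse where nonzero, the two descriptions give the same edges;
  including both makes the definition independent of that fact.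
\<close>

definition crystal_edges :: "nat set \<Rightarrow> nat rel \<Rightarrow> nat \<Rightarrow> array rel" where
  "crystal_edges P le r =
     {(A, B). (A \<in> P_arrays P le \<and> lower le r A = Some B) \<or>
              (B \<in> P_arrays P le \<and> raise le r B = Some A)}"

definition crystal_connected :: "nat set \<Rightarrow> nat rel \<Rightarrow> array rel" where
  "crystal_connected P le =
     {(A, B) \<in> P_arrays P le \<times> P_arrays P le.
        (A, B) \<in> (let E = (\<Union>r\<in>{1..}. crystal_edges P le r) in (E \<union> E\<inverse>)\<^sup>*)}"

definition crystal_components :: "nat set \<Rightarrow> nat rel \<Rightarrow> array set set" where
  "crystal_components P le = P_arrays P le // crystal_connected P le"

end

theory Submission
  imports Defs
begin

text \<open>
  An operator of color \<open>r\<close> moves a set \<open>S\<close> from one of the rows \<open>r\<close>, \<open>r + 1\<close> to the other and a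
  set \<open>T\<close> back. Whether a pair of elements is an ascent can change only if one of them is in \<open>S\<close>
  and the other in \<open>T\<close>, provided that \<open>S \<union> T\<close> is comparable to all other elements of the two rows.
  So it suffices to know that these other elements are indeed comparable, and that among the
  incomparable pairs in \<open>S \<times> T\<close> as many have the smaller number in \<open>S\<close> as in \<open>T\<close>.

  Both come from the shape of the alignment. The elements \<open>u\<^sub>0 \<prec> \<dots> \<prec> u\<^sub>t\<close> of \<open>S\<close> fill
  consecutive columns, and \<open>T\<close> consists of elements \<open>v\<^sub>0 \<prec> \<dots> \<prec> v\<^sub>t\<^sub>-\<^sub>1\<close>, where \<open>v\<^sub>s\<close> is in the
  column of \<open>u\<^sub>s\<^sub>+\<^sub>1\<close> and incomparable to both \<open>u\<^sub>s\<close> and \<open>u\<^sub>s\<^sub>+\<^sub>1\<close>. In a natural unit interval order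
  this forces \<open>u\<^sub>s < v\<^sub>s < u\<^sub>s\<^sub>+\<^sub>1\<close>, and makes all other pairs comparable, so each \<open>v\<^sub>s\<close> contributes
  one ascent before the move and one after it (\<open>zigzag\<close>, \<open>ascents_balanced\<close>). That nothing else is
  incomparable to \<open>S \<union> T\<close> is \<open>S_comparable\<close> and \<open>T_comparable\<close>.

  The alignment enters only through a few properties (locale \<open>aligned_rows\<close>) that do not distinguish
  the two rows, so one argument serves both the lowering and the raising operators. Columns
  increase along rows, no column is skipped, and every element has a larger one in the next column if
  that is nonempty. One more property is what makes the zigzag work. An element that has left its column in the pre-alignment shares its final column with an
  element not above it, namely the obstacle because of which it was moved; an element
  that has not moved has an unmoved element below it in the previous column, or is in column 1. The
  point is that obstacles never leave again: the procedure always moves the rightmost candidate, so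
  everything to the right of a moved element has already come to rest.
\<close>

section \<open>Natural unit interval orders\<close>

locale unit_interval_order =
  fixes P :: "nat set" and le :: "nat rel"
  assumes nuio: "natural_unit_interval_order P le"
begin

abbreviation prec :: "nat \<Rightarrow> nat \<Rightarrow> bool" (infix "\<prec>" 50)
  where "x \<prec> y \<equiv> less_P le x y"

abbreviation par :: "nat \<Rightarrow> nat \<Rightarrow> bool" (infix "\<parallel>" 50)
  where "x \<parallel> y \<equiv> incomparable le x y"

lemma finite_P: "finite P"
  using nuio by (simp add: natural_unit_interval_order_def)

lemma prec_less: "x \<in> P \<Longrightarrow> y \<in> P \<Longrightarrow> x \<prec> y \<Longrightarrow> x < y"
  using nuio by (simp add: natural_unit_interval_order_def)

lemma prec_irrefl [simp]: "\<not> x \<prec> x"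
  by (simp add: less_P_def)

lemma prec_trans:
  assumes "x \<prec> y" "y \<prec> z"
  shows "x \<prec> z"
proof -
  have "trans le" "antisym le"
    using nuio by (auto simp: natural_unit_interval_order_def partial_order_on_def preorder_on_def)
  then show ?thesis
    using assms unfolding less_P_def by (metis antisymD transD)
qed

lemma par_iff: "x \<in> P \<Longrightarrow> y \<in> P \<Longrightarrow> x \<parallel> y \<longleftrightarrow> x \<noteq> y \<and> \<not> x \<prec> y \<and> \<not> y \<prec> x"
  using nuio
  by (auto simp: natural_unit_interval_order_def partial_order_on_def preorder_on_def
      refl_on_def less_P_def incomparable_def)

lemma par_sym: "x \<parallel> y \<longleftrightarrow> y \<parallel> x"
  by (auto simp: incomparable_def)

lemma between:
  assumes "u \<in> P" "v \<in> P" "w \<in> P" "u \<prec> w" "v \<parallel> w" "v \<parallel> u"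
  shows "u < v" "v < w"
  using nuio assms unfolding natural_unit_interval_order_def by blast+

text \<open>
  This and its mirror image say that \<open>\<prec>\<close> only compares how far apart numbers are. If \<open>x \<prec> y'\<close>
  failed, then \<open>y'\<close> would be incomparable to both \<open>x\<close> and \<open>y\<close>, so would lie between them.
\<close>

lemma prec_mono_right:
  assumes "x \<in> P" "y \<in> P" "y' \<in> P" "x \<prec> y" "y < y'"
  shows "x \<prec> y'"
proof (rule ccontr)
  assume neg: "\<not> x \<prec> y'"
  have "y' \<parallel> y" "y' \<parallel> x"
    using assms neg prec_less[of x y] prec_less[of y' y] prec_less[of y' x] prec_trans[of x y y']
    by (auto simp: par_iff)
  then show False
    using between[of x y' y] assms by simp
qed

lemma prec_mono_left:
  assumes "x' \<in> P" "x \<in> P" "y \<in> P" "x' < x" "x \<prec> y"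
  shows "x' \<prec> y"
proof (rule ccontr)
  assume neg: "\<not> x' \<prec> y"
  have "x' \<parallel> y" "x' \<parallel> x"
    using assms neg prec_less[of x y] prec_less[of y x'] prec_less[of x x'] prec_trans[of x' x y]
    by (auto simp: par_iff)
  then show False
    using between[of x x' y] assms by simp
qed

end

section \<open>Invariants of the alignment procedure\<close>

text \<open>
  \<open>U\<close> and \<open>V\<close> are the element sets of two adjacent rows. It is left open which of them is the upper
  one, so that results can be used with the two exchanged.
\<close>

locale two_rows = unit_interval_order +
  fixes U V :: "nat set"
  assumes U_sub: "U \<subseteq> P" and V_sub: "V \<subseteq> P" and disj: "U \<inter> V = {}"
    and chain_U: "x \<in> U \<Longrightarrow> y \<in> U \<Longrightarrow> x \<noteq> y \<Longrightarrow> x \<prec> y \<or> y \<prec> x"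
    and chain_V: "x \<in> V \<Longrightarrow> y \<in> V \<Longrightarrow> x \<noteq> y \<Longrightarrow> x \<prec> y \<or> y \<prec> x"
begin

lemma finite_rows: "finite (U \<union> V)"
  using U_sub V_sub finite_P by (meson finite_subset finite_Un)

lemma in_P: "x \<in> U \<union> V \<Longrightarrow> x \<in> P"
  using U_sub V_sub by blast

end

text \<open>
  What matters about the pre-alignment \<open>C\<close> is that each column is caused by a chain: an
  element beyond column 1 is there because of a smaller element just before it. Elements of
  different rows need not be in the order of their columns, as \<open>a \<prec> b\<close> is possible for elements \<open>a\<close>
  of row \<open>r\<close> and \<open>b\<close> of row \<open>r + 1\<close> in the same column.
\<close>

locale pre_aligned = two_rows +
  fixes C :: "nat \<Rightarrow> nat"
  assumes C_mono_U: "x \<in> U \<Longrightarrow> y \<in> U \<Longrightarrow> x \<prec> y \<Longrightarrow> C x < C y"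
    and C_mono_V: "x \<in> V \<Longrightarrow> y \<in> V \<Longrightarrow> x \<prec> y \<Longrightarrow> C x < C y"
    and C_pred: "y \<in> U \<union> V \<Longrightarrow> C y = 1 \<or> (\<exists>z\<in>U \<union> V. z \<prec> y \<and> Suc (C z) = C y)"
begin

abbreviation mov :: "(nat \<Rightarrow> nat) \<Rightarrow> nat \<Rightarrow> bool"
  where "mov \<equiv> movable le (U \<union> V)"

text \<open>
  In the last clause, \<open>z\<close> is the obstacle in whose column \<open>y\<close> came to rest. For \<open>z\<close> to stay there
  it has to be immovable, and it remains so as long as the column after it loses nothing; hence the
  bound on the columns of movable elements. It is not strict because \<open>y\<close> itself may move on.
\<close>

definition align_inv :: "(nat \<Rightarrow> nat) \<Rightarrow> bool" where
  "align_inv \<phi> \<longleftrightarrow>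
     (\<forall>x\<in>U \<union> V. \<forall>y\<in>U \<union> V. x \<prec> y \<and> C x < C y \<longrightarrow> \<phi> x < \<phi> y) \<and>
     (\<forall>x\<in>U \<union> V. C x \<le> \<phi> x \<and> \<phi> x \<le> Max (C ` (U \<union> V))) \<and>
     (\<forall>x\<in>U \<union> V. 1 < \<phi> x \<longrightarrow> (\<exists>y\<in>U \<union> V. Suc (\<phi> y) = \<phi> x)) \<and>
     (\<forall>y\<in>U \<union> V. \<phi> y \<noteq> C y \<longrightarrow>
        (\<exists>z\<in>U \<union> V. z \<noteq> y \<and> \<phi> z = \<phi> y \<and> \<not> y \<prec> z \<and> \<not> mov \<phi> z) \<and>
        (\<forall>w. mov \<phi> w \<longrightarrow> \<phi> w \<le> \<phi> y))"

lemma C_pos: "x \<in> U \<union> V \<Longrightarrow> 1 \<le> C x"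
  using C_pred[of x] by auto

lemma align_inv_pre: "align_inv C"
proof -
  have "C x \<le> Max (C ` (U \<union> V))" if "x \<in> U \<union> V" for x
    using that finite_rows by (intro Max_ge finite_imageI imageI)
  moreover have "\<exists>y\<in>U \<union> V. Suc (C y) = C x" if "x \<in> U \<union> V" "1 < C x" for x
    using C_pred[OF that(1)] that(2) by auto
  ultimately show ?thesis
    unfolding align_inv_def by blast
qed

lemma same_row_mono:
  assumes "align_inv \<phi>" "x \<in> U \<and> y \<in> U \<or> x \<in> V \<and> y \<in> V" "x \<prec> y"
  shows "\<phi> x < \<phi> y"
  using assms C_mono_U C_mono_V unfolding align_inv_def by blast

lemma same_row_col:
  assumes "align_inv \<phi>" "x \<in> U \<and> y \<in> U \<or> x \<in> V \<and> y \<in> V" "\<phi> x = \<phi> y"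
  shows "x = y"
  using same_row_mono[OF assms(1)] assms(2,3) chain_U chain_V by (metis less_irrefl)

lemma same_row_next:
  assumes "align_inv \<phi>" "x \<in> U \<and> y \<in> U \<or> x \<in> V \<and> y \<in> V" "\<phi> x < \<phi> y"
  shows "x \<prec> y"
  using same_row_mono[OF assms(1)] assms(2,3) chain_U chain_V by (metis less_asym less_irrefl)

text \<open>
  This is why moves open no gap. Let \<open>y\<close> be the obstacle in the column after \<open>x\<close>. It has not moved,
  since otherwise that column would hold elements of both rows, one of them above \<open>x\<close>. So \<open>y\<close> is in
  its column because of some \<open>z \<prec> y\<close>, which is now in the column of \<open>x\<close> and differs from \<open>x\<close>.
\<close>

lemma movable_shares_column:
  assumes inv: "align_inv \<phi>" and x: "mov \<phi> x"
  shows "\<exists>x'\<in>U \<union> V. x' \<noteq> x \<and> \<phi> x' = \<phi> x"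
proof -
  have xX: "x \<in> U \<union> V" and no: "\<And>y. y \<in> U \<union> V \<Longrightarrow> \<phi> y = Suc (\<phi> x) \<Longrightarrow> \<not> x \<prec> y"
    using x by (auto simp: movable_def)
  obtain y where y: "y \<in> U \<union> V" "\<phi> y = Suc (\<phi> x)"
    using x by (auto simp: movable_def)
  have "\<phi> y = C y"
  proof (rule ccontr)
    assume "\<phi> y \<noteq> C y"
    then obtain z where z: "z \<in> U \<union> V" "z \<noteq> y" "\<phi> z = \<phi> y"
      using inv y unfolding align_inv_def by blast
    have "\<not> (y \<in> U \<and> z \<in> U \<or> y \<in> V \<and> z \<in> V)"
      using same_row_col[OF inv, of y z] z by auto
    then have "(x \<in> U \<and> y \<in> U \<or> x \<in> V \<and> y \<in> V) \<or> (x \<in> U \<and> z \<in> U \<or> x \<in> V \<and> z \<in> V)"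
      using xX y z by blast
    then show False
      using same_row_next[OF inv, of x y] same_row_next[OF inv, of x z] no y z by auto
  qed
  moreover have "1 \<le> \<phi> x"
    using C_pos[OF xX] inv xX unfolding align_inv_def by (meson le_trans)
  ultimately obtain z where z: "z \<in> U \<union> V" "z \<prec> y" "Suc (C z) = C y"
    using C_pred[OF y(1)] y by auto
  have "C z \<le> \<phi> z" "\<phi> z < \<phi> y"
    using inv z y unfolding align_inv_def by (blast, metis lessI)
  then have "\<phi> z = \<phi> x"
    using z y \<open>\<phi> y = C y\<close> by simp
  moreover have "z \<noteq> x"
    using z no y by auto
  ultimately show ?thesis
    using z by blast
qed

lemma align_inv_step:
  assumes inv: "align_inv \<phi>" and x: "mov \<phi> x" and right: "\<And>w. mov \<phi> w \<Longrightarrow> \<phi> w \<le> \<phi> x"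
  shows "align_inv (\<phi>(x := Suc (\<phi> x)))"
proof -
  define \<psi> where "\<psi> = \<phi>(x := Suc (\<phi> x))"
  have \<psi>x: "\<psi> x = Suc (\<phi> x)" and \<psi>: "\<And>y. y \<noteq> x \<Longrightarrow> \<psi> y = \<phi> y"
    by (auto simp: \<psi>_def)
  have xX: "x \<in> U \<union> V" and no: "\<And>y. y \<in> U \<union> V \<Longrightarrow> \<phi> y = Suc (\<phi> x) \<Longrightarrow> \<not> x \<prec> y"
    using x by (auto simp: movable_def)
  obtain y0 where y0: "y0 \<in> U \<union> V" "\<phi> y0 = Suc (\<phi> x)"
    using x by (auto simp: movable_def)
  then have y0x: "y0 \<noteq> x"
    by auto
  \<comment> \<open>The move adds \<open>x\<close> to the next column and alters none after it, so what rested there still does.\<close>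
  have still: "\<not> mov \<psi> w" if "w \<noteq> x" "\<phi> x < \<phi> w" for w
  proof
    assume m: "mov \<psi> w"
    have eq: "\<psi> y = Suc (\<phi> w) \<longleftrightarrow> \<phi> y = Suc (\<phi> w)" for y
      using that \<psi>x \<psi>[of y] by (cases "y = x") auto
    have "mov \<phi> w"
      using m eq \<psi>[OF that(1)] by (simp add: movable_def)
    then show False
      using right that by fastforce
  qed
  have a: "\<psi> y < \<psi> z" if "y \<in> U \<union> V" "z \<in> U \<union> V" "y \<prec> z" "C y < C z" for y z
  proof -
    have "\<phi> y < \<phi> z"
      using inv that unfolding align_inv_def by blast
    then show ?thesis
      using that no[of z] \<psi>x \<psi>[of y] \<psi>[of z] Suc_lessI[of "\<phi> x" "\<phi> z"]
      by (metis Suc_lessI Suc_lessD less_SucI)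
  qed
  have b: "C y \<le> \<psi> y \<and> \<psi> y \<le> Max (C ` (U \<union> V))" if "y \<in> U \<union> V" for y
  proof -
    have "C y \<le> \<phi> y" "\<phi> y \<le> Max (C ` (U \<union> V))" "\<phi> y0 \<le> Max (C ` (U \<union> V))"
      using inv that y0 unfolding align_inv_def by blast+
    then show ?thesis
      using y0 \<psi>x \<psi>[of y] by (cases "y = x") auto
  qed
  obtain x' where x': "x' \<in> U \<union> V" "x' \<noteq> x" "\<phi> x' = \<phi> x"
    using movable_shares_column[OF inv x] by blast
  have c: "\<exists>z\<in>U \<union> V. Suc (\<psi> z) = \<psi> y" if y: "y \<in> U \<union> V" "1 < \<psi> y" for y
  proof (cases "\<psi> y = Suc (\<phi> x)")
    case True
    then show ?thesis
      using x' \<psi>[of x'] by auto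
  next
    case False
    then have "y \<noteq> x"
      using \<psi>x by auto
    then obtain z where "z \<in> U \<union> V" "Suc (\<phi> z) = \<phi> y"
      using inv y \<psi>[of y] unfolding align_inv_def by metis
    then show ?thesis
      using False \<psi>[of y] \<psi>[of z] \<open>y \<noteq> x\<close> by (metis)
  qed
  have d: "(\<exists>z\<in>U \<union> V. z \<noteq> y \<and> \<psi> z = \<psi> y \<and> \<not> y \<prec> z \<and> \<not> mov \<psi> z) \<and>
        (\<forall>w. mov \<psi> w \<longrightarrow> \<psi> w \<le> \<psi> y)" if y: "y \<in> U \<union> V" "\<psi> y \<noteq> C y" for y
  proof (cases "y = x")
    case True
    have "\<psi> w \<le> \<psi> x" if "mov \<psi> w" for w
      using still[of w] that \<psi>x \<psi>[of w] by (cases "w = x"; cases "\<phi> x < \<phi> w") auto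
    moreover have "\<not> mov \<psi> y0"
      using still[OF y0x] y0 by simp
    ultimately show ?thesis
      using True y0 no[of y0] \<psi>x \<psi>[OF y0x] y0x by auto
  next
    case False
    then have "\<phi> y \<noteq> C y"
      using y \<psi>[of y] by simp
    then obtain z where z: "z \<in> U \<union> V" "z \<noteq> y" "\<phi> z = \<phi> y" "\<not> y \<prec> z" "\<not> mov \<phi> z"
      and le: "\<phi> x \<le> \<phi> y"
      using inv y x unfolding align_inv_def by blast
    have zx: "z \<noteq> x"
      using z x by auto
    \<comment> \<open>A column holds at most one element of each row, so \<open>x\<close>, \<open>y\<close> and \<open>z\<close> do not fit into one.\<close>
    have "\<phi> x \<noteq> \<phi> y"
    proof
      assume eq: "\<phi> x = \<phi> y"
      have "\<not> (y \<in> U \<and> z \<in> U \<or> y \<in> V \<and> z \<in> V)" "\<not> (x \<in> U \<and> y \<in> U \<or> x \<in> V \<and> y \<in> V)"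
        "\<not> (x \<in> U \<and> z \<in> U \<or> x \<in> V \<and> z \<in> V)"
        using same_row_col[OF inv] z eq zx False by metis+
      then show False
        using z y xX by blast
    qed
    then have lt: "\<phi> x < \<phi> y"
      using le by simp
    have "\<not> mov \<psi> z"
      using still[OF zx] lt z by simp
    moreover have "\<psi> w \<le> \<psi> y" if "mov \<psi> w" for w
      using still[of w] that \<psi>x \<psi>[of w] \<psi>[OF False] lt by (cases "w = x"; cases "\<phi> x < \<phi> w") auto
    ultimately show ?thesis
      using z \<psi>[OF zx] \<psi>[OF False] by auto
  qed
  have "align_inv \<psi>"
    unfolding align_inv_def using a b c d by blast
  then show ?thesis
    by (simp add: \<psi>_def)
qed

text \<open>
  The bound on the columns is what makes \<open>ARG_MAX\<close> well-behaved: columns are natural numbers, and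
  without a bound a maximum need not exist.
\<close>

lemma align_step_rightmost:
  assumes inv: "align_inv \<phi>" and ex: "\<exists>x. mov \<phi> x"
  obtains x where "mov \<phi> x" "\<And>w. mov \<phi> w \<Longrightarrow> \<phi> w \<le> \<phi> x"
    "align_step le (U \<union> V) \<phi> = \<phi>(x := Suc (\<phi> x))"
proof -
  obtain x0 where x0: "mov \<phi> x0"
    using ex by blast
  have "\<forall>y. mov \<phi> y \<longrightarrow> \<phi> y < Suc (Max (C ` (U \<union> V)))"
    using inv unfolding align_inv_def movable_def by (meson le_imp_less_Suc)
  note bound = x0 this
  show thesis
    using that[OF arg_max_natI[OF bound] arg_max_nat_le[OF _ bound(2)]]
    by (simp add: align_step_def Let_def)
qed

text \<open>
  Elements move only into nonempty columns, so no element passes the last column of the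
  pre-alignment, while each step increases the sum of the columns.
\<close>

lemma alignment_terminates:
  fixes \<Phi> :: "nat \<Rightarrow> nat \<Rightarrow> nat"
  defines "\<Phi> \<equiv> \<lambda>k. (align_step le (U \<union> V) ^^ k) C"
  defines "K \<equiv> LEAST k. \<not> (\<exists>x. mov (\<Phi> k) x)"
  shows "align_inv (\<Phi> K) \<and> \<not> (\<exists>x. mov (\<Phi> K) x)"
proof -
  have \<Phi>_Suc: "\<Phi> (Suc k) = align_step le (U \<union> V) (\<Phi> k)" and \<Phi>_0: "\<Phi> 0 = C" for k
    by (simp_all add: \<Phi>_def)
  have run: "align_inv (\<Phi> k) \<and> k \<le> sum (\<Phi> k) (U \<union> V)"
    if "\<And>j. j < k \<Longrightarrow> \<exists>x. mov (\<Phi> j) x" for k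
    using that
  proof (induction k)
    case 0
    then show ?case
      by (simp add: \<Phi>_0 align_inv_pre)
  next
    case (Suc k)
    then have inv: "align_inv (\<Phi> k)" and k: "k \<le> sum (\<Phi> k) (U \<union> V)"
      by simp_all
    obtain x where x: "mov (\<Phi> k) x" "\<And>w. mov (\<Phi> k) w \<Longrightarrow> \<Phi> k w \<le> \<Phi> k x"
      and eq: "\<Phi> (Suc k) = (\<Phi> k)(x := Suc (\<Phi> k x))"
      using align_step_rightmost[OF inv] Suc.prems[of k] \<Phi>_Suc by (metis lessI)
    have "sum (\<Phi> k) (U \<union> V) < sum (\<Phi> (Suc k)) (U \<union> V)"
      by (rule sum_strict_mono_ex1) (use finite_rows x(1) in \<open>auto simp: eq movable_def\<close>)
    then show ?case
      using align_inv_step[OF inv x] k unfolding eq by linarith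
  qed
  have "\<exists>k. \<not> (\<exists>x. mov (\<Phi> k) x)"
  proof (rule ccontr)
    assume "\<not> ?thesis"
    then have *: "align_inv (\<Phi> k)" "k \<le> sum (\<Phi> k) (U \<union> V)" for k
      using run by blast+
    have "sum (\<Phi> k) (U \<union> V) \<le> card (U \<union> V) * Max (C ` (U \<union> V))" for k
      using sum_bounded_above[of "U \<union> V" "\<Phi> k" "Max (C ` (U \<union> V))"] *(1)[of k]
      unfolding align_inv_def by simp
    then show False
      using *(2) by (meson not_less_eq_eq le_trans)
  qed
  then have "\<not> (\<exists>x. mov (\<Phi> K) x)"
    unfolding K_def by (rule LeastI_ex)
  moreover have "align_inv (\<Phi> K)"
    using run[of K] not_less_Least[of _ "\<lambda>k. \<not> (\<exists>x. mov (\<Phi> k) x)"] unfolding K_def by simp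
  ultimately show ?thesis
    by blast
qed

end

section \<open>Aligned rows and the strings that the operators move\<close>

text \<open>
  \<open>M\<close> stands for the set of elements that have left their column in the pre-alignment. The
  column-mate \<open>z\<close> in \<open>moved\<close> is necessarily in the other row.
\<close>

locale aligned_rows = two_rows +
  fixes \<phi> :: "nat \<Rightarrow> nat" and M :: "nat set"
  assumes col_mono_U: "x \<in> U \<Longrightarrow> y \<in> U \<Longrightarrow> x \<prec> y \<Longrightarrow> \<phi> x < \<phi> y"
    and col_mono_V: "x \<in> V \<Longrightarrow> y \<in> V \<Longrightarrow> x \<prec> y \<Longrightarrow> \<phi> x < \<phi> y"
    and stable: "x \<in> U \<union> V \<Longrightarrow> y \<in> U \<union> V \<Longrightarrow> \<phi> y = Suc (\<phi> x) \<Longrightarrow>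
      \<exists>z\<in>U \<union> V. \<phi> z = Suc (\<phi> x) \<and> x \<prec> z"
    and no_gap: "x \<in> U \<union> V \<Longrightarrow> 1 < \<phi> x \<Longrightarrow> \<exists>y\<in>U \<union> V. Suc (\<phi> y) = \<phi> x"
    and col_pos: "x \<in> U \<union> V \<Longrightarrow> 1 \<le> \<phi> x"
    and moved: "y \<in> U \<union> V \<Longrightarrow> y \<in> M \<Longrightarrow> \<exists>z\<in>U \<union> V. z \<noteq> y \<and> \<phi> z = \<phi> y \<and> \<not> y \<prec> z"
    and unmoved: "y \<in> U \<union> V \<Longrightarrow> y \<notin> M \<Longrightarrow>
      \<phi> y = 1 \<or> (\<exists>z\<in>U \<union> V. z \<notin> M \<and> z \<prec> y \<and> Suc (\<phi> z) = \<phi> y)"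
begin

lemma flip: "aligned_rows P le V U \<phi> M"
proof (unfold_locales, unfold Un_commute[of V U])
  show "V \<subseteq> P" "U \<subseteq> P" "V \<inter> U = {}"
    using U_sub V_sub disj by auto
qed (fact chain_U chain_V col_mono_U col_mono_V stable no_gap col_pos moved unmoved)+

lemma U_col_less: "x \<in> U \<Longrightarrow> y \<in> U \<Longrightarrow> \<phi> x < \<phi> y \<longleftrightarrow> x \<prec> y"
  using col_mono_U[of x y] col_mono_U[of y x] chain_U[of x y] by (cases "x = y") auto

lemma V_col_less: "x \<in> V \<Longrightarrow> y \<in> V \<Longrightarrow> \<phi> x < \<phi> y \<longleftrightarrow> x \<prec> y"
  using col_mono_V[of x y] col_mono_V[of y x] chain_V[of x y] by (cases "x = y") auto

lemma U_col_inj: "x \<in> U \<Longrightarrow> y \<in> U \<Longrightarrow> \<phi> x = \<phi> y \<Longrightarrow> x = y"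
  using col_mono_U[of x y] col_mono_U[of y x] chain_U[of x y] by (cases "x = y") auto

lemma V_col_inj: "x \<in> V \<Longrightarrow> y \<in> V \<Longrightarrow> \<phi> x = \<phi> y \<Longrightarrow> x = y"
  using col_mono_V[of x y] col_mono_V[of y x] chain_V[of x y] by (cases "x = y") auto

lemma larger_in_later_column:
  assumes "x \<in> U \<union> V" "y \<in> U \<union> V" "\<phi> x < \<phi> y"
  shows "\<exists>z\<in>U \<union> V. \<phi> z = \<phi> y \<and> x \<prec> z"
  using assms(2,3)
proof (induction "\<phi> y" arbitrary: y rule: less_induct)
  case less
  then obtain y' where y': "y' \<in> U \<union> V" "Suc (\<phi> y') = \<phi> y"
    using no_gap[of y] col_pos[OF assms(1)] by auto
  show ?case
  proof (cases "\<phi> y' = \<phi> x")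
    case True
    then show ?thesis
      using stable[OF assms(1) less.prems(1)] y' by auto
  next
    case False
    then obtain z' where "z' \<in> U \<union> V" "\<phi> z' = \<phi> y'" "x \<prec> z'"
      using less.hyps[of y'] y' less.prems by auto
    then show ?thesis
      using stable[of z' y] y' less.prems prec_trans by (metis)
  qed
qed

end

text \<open>
  Both operators move a string of consecutive elements \<open>us ! p, \<dots>, us ! (p + t)\<close> from the row \<open>U\<close>
  to the row \<open>V\<close>: lowering with \<open>U\<close> the upper row, raising with \<open>U\<close> the lower one. The string
  starts at an element that is alone in its column, and it goes on for as long as the next column
  has an element of \<open>V\<close> that is not above the current one.
\<close>

locale moving_string = aligned_rows +
  fixes us :: "nat list" and p t :: nat
  assumes set_us: "set us = U" and sorted_us: "sorted_wrt prec us"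
    and free: "v \<in> V \<Longrightarrow> \<phi> v \<noteq> \<phi> (us ! p)"
    and t_length: "p + t < length us"
    and t_stop: "v \<in> V \<Longrightarrow> \<phi> v = Suc (\<phi> (us ! (p + t))) \<Longrightarrow> us ! (p + t) \<prec> v"
    and t_go: "s < t \<Longrightarrow> \<exists>v\<in>V. \<phi> v = Suc (\<phi> (us ! (p + s))) \<and> \<not> us ! (p + s) \<prec> v"
begin

definition u :: "nat \<Rightarrow> nat" where
  "u s = us ! (p + s)"

text \<open>
  The element of \<open>V\<close> one column to the right of \<open>u s\<close>, hence in the column of \<open>u (Suc s)\<close>; it is
  meaningful for \<open>s < t\<close>.
\<close>

definition v :: "nat \<Rightarrow> nat" where
  "v s = (SOME v. v \<in> V \<and> \<phi> v = Suc (\<phi> (u s)) \<and> \<not> u s \<prec> v)"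

definition S :: "nat set" where
  "S = {us ! i | i. p \<le> i \<and> i \<le> p + t}"

definition T :: "nat set" where
  "T = {v \<in> V. \<exists>u\<in>S. \<phi> v = \<phi> u}"

lemma u_U: "s \<le> t \<Longrightarrow> u s \<in> U"
  using nth_mem[of "p + s" us] t_length unfolding u_def set_us by simp

lemma u_prec: "i < j \<Longrightarrow> j \<le> t \<Longrightarrow> u i \<prec> u j"
  using sorted_us t_length by (auto simp: u_def sorted_wrt_iff_nth_less)

lemma v_props: "s < t \<Longrightarrow> v s \<in> V \<and> \<phi> (v s) = Suc (\<phi> (u s)) \<and> \<not> u s \<prec> v s"
  unfolding v_def by (rule someI_ex) (use t_go in \<open>auto simp: u_def\<close>)

lemma S_eq: "S = u ` {..t}"
proof -
  have "us ! i \<in> u ` {..t}" if "p \<le> i" "i \<le> p + t" for i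
    using that by (intro image_eqI[of _ _ "i - p"]) (auto simp: u_def)
  then show ?thesis
    unfolding S_def by (auto simp: u_def)
qed

lemma S_U: "S \<subseteq> U"
  using u_U by (auto simp: S_eq)

text \<open>
  The string has no gaps: \<open>u s\<close> has something above it in the next column, which is not \<open>v s\<close> and
  thus belongs to \<open>U\<close>.
\<close>

lemma u_next_col:
  assumes "s < t"
  shows "\<phi> (u (Suc s)) = Suc (\<phi> (u s))"
proof -
  note v = v_props[OF assms]
  have us: "u s \<in> U" "u (Suc s) \<in> U"
    using u_U assms by auto
  obtain z where z: "z \<in> U \<union> V" "\<phi> z = Suc (\<phi> (u s))" "u s \<prec> z"
    using stable[of "u s" "v s"] v us by auto
  then have "z \<in> U"
    using v V_col_inj[of z "v s"] by auto
  then obtain j where j: "j < length us" "z = us ! j"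
    using set_us by (metis in_set_conv_nth)
  have "p + Suc s \<le> j"
  proof (rule ccontr)
    assume "\<not> p + Suc s \<le> j"
    then have "j = p + s \<or> z \<prec> u s"
      using j sorted_wrt_nth_less[OF sorted_us, of j "p + s"] assms t_length
      by (cases "j = p + s") (auto simp: u_def)
    then show False
      using z j U_col_less[OF \<open>z \<in> U\<close> us(1)] by (auto simp: u_def)
  qed
  then have "u (Suc s) = z \<or> u (Suc s) \<prec> z"
    using j sorted_us by (auto simp: u_def sorted_wrt_iff_nth_less le_eq_less_or_eq)
  then have "\<phi> (u (Suc s)) \<le> \<phi> z"
    using U_col_less[OF us(2) \<open>z \<in> U\<close>] by auto
  moreover have "\<phi> (u s) < \<phi> (u (Suc s))"
    using col_mono_U us u_prec[of s "Suc s"] assms by auto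
  ultimately show ?thesis
    using z by simp
qed

lemma u_col: "s \<le> t \<Longrightarrow> \<phi> (u s) = \<phi> (u 0) + s"
  by (induction s) (auto simp: u_next_col)

lemma T_eq: "T = v ` {..<t}"
proof
  show "v ` {..<t} \<subseteq> T"
  proof
    fix y assume "y \<in> v ` {..<t}"
    then obtain s where "s < t" "y = v s"
      by auto
    then show "y \<in> T"
      unfolding T_def S_eq using v_props[of s] u_next_col[of s] by (auto intro!: bexI[of _ "Suc s"])
  qed
  show "T \<subseteq> v ` {..<t}"
  proof
    fix y assume "y \<in> T"
    then obtain s where s: "s \<le> t" "y \<in> V" "\<phi> y = \<phi> (u s)"
      unfolding T_def S_eq by auto
    then have "s \<noteq> 0"
      using free[of y] by (cases s) (auto simp: u_def)
    then obtain s' where s': "s = Suc s'"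
      by (cases s) auto
    then have "y = v s'"
      using V_col_inj[of y "v s'"] v_props[of s'] u_next_col[of s'] s by auto
    then show "y \<in> v ` {..<t}"
      using s s' by auto
  qed
qed

text \<open>
  An unmoved \<open>v s\<close> would have an unmoved \<open>z \<prec> v s\<close> in the column of \<open>u s\<close>. As \<open>u s \<prec> v s\<close> fails,
  \<open>z\<close> is in \<open>V\<close>; but there is no such element in the column of \<open>u 0\<close>, and in later ones it is
  \<open>v (s - 1)\<close>, which has moved by induction.
\<close>

lemma v_moved: "s < t \<Longrightarrow> v s \<in> M"
proof (induction s)
  case 0
  note v = v_props[OF 0]
  show ?case
  proof (rule ccontr)
    assume "v 0 \<notin> M"
    then obtain z where z: "z \<in> U \<union> V" "z \<prec> v 0" "Suc (\<phi> z) = \<phi> (v 0)"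
      using unmoved[of "v 0"] v col_pos[of "u 0"] u_U[of 0] by auto
    then have "z \<noteq> u 0" "\<phi> z = \<phi> (u 0)"
      using v by auto
    then show False
      using z free[of z] U_col_inj[of z "u 0"] u_U[of 0] by (auto simp: u_def)
  qed
next
  case (Suc s)
  note v = v_props[OF Suc.prems] and v' = v_props[OF Suc_lessD[OF Suc.prems]]
  show ?case
  proof (rule ccontr)
    assume "v (Suc s) \<notin> M"
    then obtain z where z: "z \<in> U \<union> V" "z \<notin> M" "z \<prec> v (Suc s)" "Suc (\<phi> z) = \<phi> (v (Suc s))"
      using unmoved[of "v (Suc s)"] v col_pos[of "u (Suc s)"] u_U[of "Suc s"] Suc.prems by auto
    then have "z \<noteq> u (Suc s)" "\<phi> z = \<phi> (u (Suc s))"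
      using v by auto
    moreover from this have "z \<in> V"
      using z U_col_inj[of z "u (Suc s)"] u_U[of "Suc s"] Suc.prems by auto
    ultimately have "z = v s"
      using v' V_col_inj[of z "v s"] u_next_col[of s] Suc.prems by auto
    then show False
      using z Suc by simp
  qed
qed

text \<open>
  The obstacle of the moved \<open>v s\<close> is \<open>u (Suc s)\<close>, so \<open>v s \<prec> u (Suc s)\<close> fails, just as \<open>u s \<prec> v s\<close>
  does. Any other relation between \<open>v s\<close> and \<open>u s\<close> or \<open>u (Suc s)\<close> would imply one of these two.
\<close>

lemma zigzag:
  assumes "s < t"
  shows "u s \<parallel> v s" "u (Suc s) \<parallel> v s" "u s < v s" "v s < u (Suc s)"
proof -
  note v = v_props[OF assms]
  have us: "u s \<in> U" "u (Suc s) \<in> U" "u s \<prec> u (Suc s)"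
    using u_U u_prec assms by auto
  obtain z where z: "z \<in> U \<union> V" "z \<noteq> v s" "\<phi> z = \<phi> (v s)" "\<not> v s \<prec> z"
    using moved[OF _ v_moved[OF assms]] v by auto
  have "z = u (Suc s)"
    using z v V_col_inj[of z "v s"] U_col_inj[of z "u (Suc s)"] us u_next_col[OF assms] by auto
  then have 1: "\<not> v s \<prec> u (Suc s)" "\<not> u s \<prec> v s"
    using z v by auto
  have "\<not> v s \<prec> u s" "\<not> u (Suc s) \<prec> v s"
    using 1 us prec_trans by blast+
  moreover have P: "u s \<in> P" "u (Suc s) \<in> P" "v s \<in> P"
    using us v in_P by auto
  moreover have "v s \<noteq> u s" "v s \<noteq> u (Suc s)"
    using us v disj by auto
  ultimately show par: "u s \<parallel> v s" "u (Suc s) \<parallel> v s"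
    using 1 by (auto simp: par_iff)
  show "u s < v s" "v s < u (Suc s)"
    using between[of "u s" "v s" "u (Suc s)"] P us par par_sym by blast+
qed

lemma u_before_v:
  assumes "i < s" "s < t"
  shows "u i \<prec> v s"
  using prec_mono_right[of "u i" "u s" "v s"] u_prec[of i s] zigzag(3)[of s] assms
    u_U[of i] u_U[of s] v_props[of s] in_P by auto

lemma v_before_u:
  assumes "Suc s < i" "i \<le> t"
  shows "v s \<prec> u i"
  using prec_mono_left[of "v s" "u (Suc s)" "u i"] u_prec[of "Suc s" i] zigzag(4)[of s] assms
    u_U[of i] u_U[of "Suc s"] v_props[of s] in_P by auto

text \<open>
  The incomparable pairs are exactly those of \<open>zigzag\<close>: \<open>(u s, v s)\<close> has the smaller number in
  \<open>S\<close>, and \<open>(u (Suc s), v s)\<close> has it in \<open>T\<close>.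
\<close>

lemma ascents_balanced:
  "card {(x, y). x \<in> S \<and> y \<in> T \<and> x \<parallel> y \<and> x < y} =
   card {(x, y). x \<in> S \<and> y \<in> T \<and> x \<parallel> y \<and> y < x}"
proof -
  have uP: "i \<le> t \<Longrightarrow> u i \<in> P" and vP: "i < t \<Longrightarrow> v i \<in> P" for i
    using u_U[of i] v_props[of i] in_P by auto
  have only: "i = s \<or> i = Suc s" if "i \<le> t" "s < t" "u i \<parallel> v s" for i s
  proof (rule ccontr)
    assume "\<not> ?thesis"
    then have "u i \<prec> v s \<or> v s \<prec> u i"
      using u_before_v[of i s] v_before_u[of s i] that by linarith
    then show False
      using that uP[of i] vP[of s] by (auto simp: par_iff)
  qed
  have inj: "inj_on u {..t}"
    by (rule inj_onI) (metis atMost_iff add_left_cancel u_col)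
  have "{(x, y). x \<in> S \<and> y \<in> T \<and> x \<parallel> y \<and> x < y} = (\<lambda>s. (u s, v s)) ` {..<t}"
  proof (intro equalityI subsetI)
    fix q assume "q \<in> {(x, y). x \<in> S \<and> y \<in> T \<and> x \<parallel> y \<and> x < y}"
    then obtain i s where q: "q = (u i, v s)" "i \<le> t" "s < t" "u i \<parallel> v s" "u i < v s"
      unfolding S_eq T_eq by auto
    then show "q \<in> (\<lambda>s. (u s, v s)) ` {..<t}"
      using only[of i s] zigzag(4)[of s] by auto
  qed (use zigzag in \<open>auto simp: S_eq T_eq\<close>)
  moreover have "{(x, y). x \<in> S \<and> y \<in> T \<and> x \<parallel> y \<and> y < x} = (\<lambda>s. (u (Suc s), v s)) ` {..<t}"
  proof (intro equalityI subsetI)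
    fix q assume "q \<in> {(x, y). x \<in> S \<and> y \<in> T \<and> x \<parallel> y \<and> y < x}"
    then obtain i s where q: "q = (u i, v s)" "i \<le> t" "s < t" "u i \<parallel> v s" "v s < u i"
      unfolding S_eq T_eq by auto
    then show "q \<in> (\<lambda>s. (u (Suc s), v s)) ` {..<t}"
      using only[of i s] zigzag(3)[of s] by auto
  qed (use zigzag in \<open>auto simp: S_eq T_eq\<close>)
  moreover have "inj_on (\<lambda>s. (u s, v s)) {..<t}" "inj_on (\<lambda>s. (u (Suc s), v s)) {..<t}"
    using inj unfolding inj_on_def by fastforce+
  ultimately show ?thesis
    by (simp add: card_image)
qed

text \<open>
  Something above \<open>y\<close> is in the column of \<open>u 0\<close>, and that column holds nothing but \<open>u 0\<close>.
\<close>

lemma left_of_string_prec: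
  assumes "y \<in> V" "\<phi> y < \<phi> (u 0)"
  shows "y \<prec> u 0"
proof -
  obtain z where z: "z \<in> U \<union> V" "\<phi> z = \<phi> (u 0)" "y \<prec> z"
    using larger_in_later_column[of y "u 0"] assms u_U[of 0] by auto
  then have "z = u 0"
    using free[of z] U_col_inj[of z "u 0"] u_U[of 0] by (auto simp: u_def)
  then show ?thesis
    using z by simp
qed

text \<open>
  By \<open>t_stop\<close> and induction, only the case remains that the column before \<open>y\<close> is to the right of
  \<open>u t\<close> and holds a single element \<open>w\<close>, which is in \<open>U\<close>. Then it is enough that \<open>w \<prec> y\<close>, which holds if \<open>y\<close> has not
  moved or if no element of \<open>U\<close> shares its column. Otherwise the column-mate \<open>z\<close> of \<open>y\<close> in \<open>U\<close> does
  not lie above \<open>y\<close>. If \<open>u t \<prec> y\<close> failed now, then \<open>y\<close> would be incomparable to all of the chain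
  \<open>u t \<prec> w \<prec> z\<close>; this is impossible, as \<open>y\<close> would lie both below and above \<open>w\<close> as a number.
\<close>

lemma string_prec_right:
  assumes "y \<in> V" "\<phi> (u t) < \<phi> y"
  shows "u t \<prec> y"
  using assms
proof (induction "\<phi> y" arbitrary: y rule: less_induct)
  case less
  have ut: "u t \<in> U"
    using u_U by simp
  have "1 < \<phi> y"
    using less.prems col_pos[of "u t"] ut by auto
  then obtain w where w: "w \<in> U \<union> V" "Suc (\<phi> w) = \<phi> y"
    using no_gap[of y] less.prems by auto
  show ?case
  proof (cases "\<phi> w = \<phi> (u t)")
    case True
    then show ?thesis
      using t_stop[of y] less.prems w by (simp add: u_def)
  next
    case False
    then have far: "\<phi> (u t) < \<phi> w"
      using w less.prems by simp
    show ?thesis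
    proof (cases "\<exists>w'\<in>V. \<phi> w' = \<phi> w")
      case True
      then obtain w' where w': "w' \<in> V" "\<phi> w' = \<phi> w"
        by blast
      then have "u t \<prec> w'"
        using less.hyps[of w'] w far by simp
      moreover have "w' \<prec> y"
        using V_col_less[of w' y] w w' less.prems by simp
      ultimately show ?thesis
        using prec_trans by blast
    next
      case onlyU: False
      then have wU: "w \<in> U"
        using w by auto
      then have uw: "u t \<prec> w"
        using U_col_less[OF ut wU] far by simp
      obtain z where z: "z \<in> U \<union> V" "\<phi> z = \<phi> y" "w \<prec> z"
        using stable[of w y] w less.prems by auto
      show ?thesis
      proof (cases "z \<in> V")
        case True
        then have "z = y"
          using V_col_inj z less.prems by blast
        then show ?thesis
          using z uw prec_trans by blast
      next
        case False
        then have zU: "z \<in> U"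
          using z by simp
        show ?thesis
        proof (cases "y \<in> M")
          case False
          then obtain q where q: "q \<in> U \<union> V" "q \<prec> y" "Suc (\<phi> q) = \<phi> y"
            using unmoved[of y] \<open>1 < \<phi> y\<close> less.prems by auto
          then have "q = w"
            using onlyU w U_col_inj[OF _ wU, of q] by auto
          then show ?thesis
            using q uw prec_trans by blast
        next
          case True
          then obtain q where q: "q \<in> U \<union> V" "q \<noteq> y" "\<phi> q = \<phi> y" "\<not> y \<prec> q"
            using moved[of y] less.prems by auto
          then have "q = z"
            using V_col_inj[of q y] U_col_inj[of q z] zU z less.prems by auto
          then have nyz: "\<not> y \<prec> z"
            using q by simp
          show ?thesis
          proof (rule ccontr)
            assume no: "\<not> u t \<prec> y"
            have P: "u t \<in> P" "w \<in> P" "z \<in> P" "y \<in> P"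
              using ut w z less.prems in_P by auto
            have "y \<noteq> u t" "y \<noteq> w" "y \<noteq> z"
              using ut wU zU less.prems disj by auto
            moreover have "\<not> y \<prec> w" "\<not> y \<prec> u t" "\<not> w \<prec> y" "\<not> z \<prec> y"
              using no nyz uw z(3) prec_trans by blast+
            ultimately have "y \<parallel> u t" "y \<parallel> w" "y \<parallel> z"
              using P no nyz by (simp_all add: par_iff)
            then have "y < w" "w < y"
              using between[of "u t" y w] between[of w y z] P uw z by auto
            then show False
              by simp
          qed
        qed
      qed
    qed
  qed
qed

lemma S_comparable:
  assumes "x \<in> S" "y \<in> V - T"
  shows "\<not> x \<parallel> y"
proof -
  obtain s where s: "s \<le> t" "x = u s"
    using assms by (auto simp: S_eq)
  have "\<phi> y < \<phi> (u 0) \<or> \<phi> (u t) < \<phi> y"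
  proof (rule ccontr)
    assume "\<not> ?thesis"
    then obtain s' where "s' \<le> t" "\<phi> y = \<phi> (u 0) + s'"
      using u_col[of t] by (metis add_le_cancel_left le_iff_add linorder_not_le order_refl)
    then have "y \<in> T"
      using assms u_col[of s'] unfolding T_def S_eq by force
    then show False
      using assms by simp
  qed
  then have "y \<prec> u 0 \<or> u t \<prec> y"
    using left_of_string_prec string_prec_right assms by auto
  moreover have "u 0 = x \<or> u 0 \<prec> x" "x = u t \<or> x \<prec> u t"
    using s u_prec[of 0 s] u_prec[of s t] by (auto simp: le_less)
  ultimately have "y \<prec> x \<or> x \<prec> y"
    using prec_trans[of y "u 0" x] prec_trans[of x "u t" y] by auto
  then show ?thesis
    using assms S_U in_P by (auto simp: par_iff)
qed

text \<open>
  Here \<open>zigzag\<close> suffices: as a number, each \<open>v s\<close> is between two elements of the string, while \<open>x\<close>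
  is related to both of them in the same direction.
\<close>

lemma T_comparable:
  assumes "y \<in> T" "x \<in> U - S"
  shows "\<not> y \<parallel> x"
proof -
  obtain s where s: "s < t" "y = v s"
    using assms by (auto simp: T_eq)
  obtain i where i: "i < length us" "x = us ! i"
    using assms set_us by (metis DiffD1 in_set_conv_nth)
  moreover have "us ! i \<in> S" if "p \<le> i" "i \<le> p + t"
    using that by (auto simp: S_def)
  ultimately have "i < p \<or> p + t < i"
    using assms(2) not_le by blast
  with i have "x \<prec> u s \<or> u (Suc s) \<prec> x"
    using s t_length sorted_wrt_nth_less[OF sorted_us, of i "p + s"]
      sorted_wrt_nth_less[OF sorted_us, of "p + Suc s" i] by (auto simp: u_def)
  moreover have P: "x \<in> P" "y \<in> P" "u s \<in> P" "u (Suc s) \<in> P"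
    using assms s u_U[of s] u_U[of "Suc s"] v_props[of s] in_P by auto
  ultimately have "x \<prec> y \<or> y \<prec> x"
    using prec_mono_right[of x "u s" y] prec_mono_left[of y "u (Suc s)" x] zigzag(3,4)[of s] s
    by blast
  then show ?thesis
    using P by (auto simp: par_iff)
qed

end

lemma (in pre_aligned) aligned_rows_stable:
  assumes inv: "align_inv \<phi>" and stuck: "\<not> (\<exists>x. mov \<phi> x)"
  shows "aligned_rows P le U V \<phi> {y. \<phi> y \<noteq> C y}"
proof unfold_locales
  show "\<phi> x < \<phi> y" if "x \<in> U" "y \<in> U" "x \<prec> y" for x y
    using same_row_mono[OF inv] that by blast
  show "\<phi> x < \<phi> y" if "x \<in> V" "y \<in> V" "x \<prec> y" for x y
    using same_row_mono[OF inv] that by blast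
  show "\<exists>z\<in>U \<union> V. \<phi> z = Suc (\<phi> x) \<and> x \<prec> z"
    if "x \<in> U \<union> V" "y \<in> U \<union> V" "\<phi> y = Suc (\<phi> x)" for x y
    using stuck that unfolding movable_def by auto
  show "\<exists>y\<in>U \<union> V. Suc (\<phi> y) = \<phi> x" if "x \<in> U \<union> V" "1 < \<phi> x" for x
    using inv that unfolding align_inv_def by blast
  show "1 \<le> \<phi> x" if "x \<in> U \<union> V" for x
    using inv that C_pos[OF that] unfolding align_inv_def by (meson le_trans)
  show "\<exists>z\<in>U \<union> V. z \<noteq> y \<and> \<phi> z = \<phi> y \<and> \<not> y \<prec> z" if "y \<in> U \<union> V" "y \<in> {y. \<phi> y \<noteq> C y}" for y
    using inv that unfolding align_inv_def by blast
  show "\<phi> y = 1 \<or> (\<exists>z\<in>U \<union> V. z \<notin> {y. \<phi> y \<noteq> C y} \<and> z \<prec> y \<and> Suc (\<phi> z) = \<phi> y)"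
    if y: "y \<in> U \<union> V" "y \<notin> {y. \<phi> y \<noteq> C y}" for y
  proof (cases "C y = 1")
    case False
    then obtain z where z: "z \<in> U \<union> V" "z \<prec> y" "Suc (C z) = C y"
      using C_pred[OF y(1)] by blast
    have "C z \<le> \<phi> z" "\<phi> z < \<phi> y"
      using inv z y(1) unfolding align_inv_def by (blast, metis lessI)
    then show ?thesis
      using z y(2) by (intro disjI2 bexI[of _ z]) auto
  qed (use y in simp)
qed

text \<open>
  The search for \<open>t\<close> succeeds at the last element of the row at the latest: anything above it in the
  next column belongs to the other row.
\<close>

lemma (in aligned_rows) moving_string_LEAST:
  assumes us: "set us = U" "sorted_wrt prec us" and p: "p < length us"
    and free: "\<not> (\<exists>v\<in>V. \<phi> v = \<phi> (us ! p))"
  defines "t \<equiv> LEAST t. p + t < length us \<and>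
             \<not> (\<exists>v\<in>V. \<not> us ! (p + t) \<prec> v \<and> \<phi> v = \<phi> (us ! (p + t)) + 1)"
  shows "moving_string P le U V \<phi> M us p t"
proof -
  let ?Q = "\<lambda>t. p + t < length us \<and>
             \<not> (\<exists>v\<in>V. \<not> us ! (p + t) \<prec> v \<and> \<phi> v = \<phi> (us ! (p + t)) + 1)"
  let ?l = "us ! (length us - 1)"
  have l: "?l \<in> U"
    using us p by auto
  have "?Q (length us - 1 - p)"
  proof -
    have "?l \<prec> v" if v: "v \<in> V" "\<phi> v = \<phi> ?l + 1" for v
    proof -
      obtain z where z: "z \<in> U \<union> V" "\<phi> z = Suc (\<phi> ?l)" "?l \<prec> z"
        using stable[of ?l v] v l by auto
      have "z \<notin> U"
      proof
        assume "z \<in> U"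
        then obtain j where j: "j < length us" "z = us ! j"
          using us by (metis in_set_conv_nth)
        then have "j = length us - 1 \<or> z \<prec> ?l"
          using sorted_wrt_nth_less[OF us(2), of j "length us - 1"]
          by (cases "j = length us - 1") auto
        then show False
          using z j U_col_less[OF \<open>z \<in> U\<close> l] by auto
      qed
      then have "z = v"
        using V_col_inj z v by auto
      then show ?thesis
        using z by simp
    qed
    then show ?thesis
      using p by auto
  qed
  then have t: "?Q t"
    unfolding t_def by (rule LeastI)
  have "\<exists>v\<in>V. \<phi> v = Suc (\<phi> (us ! (p + s))) \<and> \<not> us ! (p + s) \<prec> v" if "s < t" for s
    using not_less_Least[of s ?Q] that t unfolding t_def[symmetric] by auto
  then show ?thesis
    using t us free by unfold_locales auto
qed

section \<open>Ascents and exchanges between adjacent rows\<close>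

text \<open>
  No row lies between \<open>r\<close> and \<open>r + 1\<close>, so the moved elements keep their position relative to all
  other rows, and only pairs between \<open>S\<close> and \<open>T\<close> can change. Before the exchange the element of
  \<open>S\<close> is in the higher row of the two, and after it the element of \<open>T\<close> is.
  The hypotheses are symmetric under exchanging \<open>(A, S)\<close> with \<open>(B, T)\<close>.
\<close>

lemma asc_exchange:
  assumes fin: "finite P"
    and A: "set (A r) = U \<union> S" "set (A (Suc r)) = V \<union> T"
    and B: "set (B r) = U \<union> T" "set (B (Suc r)) = V \<union> S"
    and AB: "\<And>i. i \<noteq> r \<Longrightarrow> i \<noteq> Suc r \<Longrightarrow> set (B i) = set (A i)"
    and only: "\<And>i. i \<noteq> r \<Longrightarrow> i \<noteq> Suc r \<Longrightarrow> set (A i) \<inter> (S \<union> T) = {}"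
    and dis: "S \<inter> T = {}" "(S \<union> T) \<inter> (U \<union> V) = {}"
    and sub: "S \<subseteq> P" "T \<subseteq> P"
    and comp: "\<And>x y. x \<in> S \<union> T \<Longrightarrow> y \<in> U \<union> V \<Longrightarrow> \<not> incomparable le x y"
    and compS: "\<And>x y. x \<in> S \<Longrightarrow> y \<in> S \<Longrightarrow> \<not> incomparable le x y"
    and compT: "\<And>x y. x \<in> T \<Longrightarrow> y \<in> T \<Longrightarrow> \<not> incomparable le x y"
    and balanced: "card {(x, y). x \<in> S \<and> y \<in> T \<and> incomparable le x y \<and> x < y} =
      card {(x, y). x \<in> S \<and> y \<in> T \<and> incomparable le x y \<and> y < x}"
  shows "asc P le A = asc P le B"
proof -
  let ?D = "\<lambda>A. {(x, y) \<in> P \<times> P. incomparable le x y \<and> x < y \<and>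
             (\<exists>i j. x \<in> set (A i) \<and> y \<in> set ((A :: array) j) \<and> i < j)}"
  let ?X = "S \<times> T \<union> T \<times> S"
  have sym: "incomparable le x y \<longleftrightarrow> incomparable le y x" for x y
    by (auto simp: incomparable_def)
  have finD: "finite (?D A)" for A
    by (rule finite_subset[of _ "P \<times> P"]) (use fin in auto)
  have rowB: "x \<in> set (B i) \<longleftrightarrow>
      (if x \<in> S then i = Suc r else if x \<in> T then i = r else x \<in> set (A i))" for x i
  proof -
    consider "i = r" | "i = Suc r" | "i \<noteq> r" "i \<noteq> Suc r"
      by blast
    then show ?thesis
    proof cases
      case 3
      then have "x \<in> set (A i) \<Longrightarrow> x \<notin> S \<union> T"
        using only[of i] by blast
      then show ?thesis
        using AB[OF 3] 3 by auto
    qed (use A B dis in auto)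
  qed
  have rowS: "x \<in> set (A i) \<longleftrightarrow> i = r" if "x \<in> S" for x i
    using only[of i] dis A that by (cases "i = r"; cases "i = Suc r") auto
  have rowT: "x \<in> set (A i) \<longleftrightarrow> i = Suc r" if "x \<in> T" for x i
    using only[of i] dis A that by (cases "i = r"; cases "i = Suc r") auto
  have rowB_S: "x \<in> S \<Longrightarrow> x \<in> set (B i) \<longleftrightarrow> i = Suc r"
    and rowB_T: "x \<in> T \<Longrightarrow> x \<in> set (B i) \<longleftrightarrow> i = r" for x i
    using rowB[of x i] dis(1) by auto
  have other: "x \<in> U \<union> V \<or> (\<forall>i. x \<in> set (A i) \<longrightarrow> i \<noteq> r \<and> i \<noteq> Suc r)" if "x \<notin> S" "x \<notin> T" for x
    using that A by auto
  have "(x, y) \<in> ?D A \<longleftrightarrow> (x, y) \<in> ?D B" if "(x, y) \<notin> ?X" for x y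
  proof (cases "incomparable le x y")
    case inc: True
    have "(\<exists>i j. x \<in> set (A i) \<and> y \<in> set (A j) \<and> i < j) \<longleftrightarrow>
          (\<exists>i j. x \<in> set (B i) \<and> y \<in> set (B j) \<and> i < j)"
    proof (cases "x \<in> S \<union> T")
      case x: True
      then have y: "y \<notin> S \<union> T"
        using that compS compT inc by blast
      then have "\<forall>i. y \<in> set (A i) \<longrightarrow> i \<noteq> r \<and> i \<noteq> Suc r"
        using other[of y] comp[OF x] inc by blast
      then have "y \<in> set (A j) \<Longrightarrow> r < j \<longleftrightarrow> Suc r < j" for j
        by (metis Suc_lessD Suc_lessI)
      then show ?thesis
        using x y by (cases "x \<in> S") (auto simp: rowB rowS rowT)
    next
      case x: False
      show ?thesis
      proof (cases "y \<in> S \<union> T")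
        case y: True
        then have "\<forall>i. x \<in> set (A i) \<longrightarrow> i \<noteq> r \<and> i \<noteq> Suc r"
          using other[of x] comp[OF y, of x] inc sym x by blast
        then have "x \<in> set (A j) \<Longrightarrow> j < r \<longleftrightarrow> j < Suc r" for j
          by (metis less_SucE less_SucI)
        then show ?thesis
          using x y by (cases "y \<in> S") (auto simp: rowB rowS rowT)
      next
        case False
        then show ?thesis
          using x by (simp add: rowB)
      qed
    qed
    then show ?thesis
      by simp
  qed simp
  then have "q \<in> ?D A - ?X \<longleftrightarrow> q \<in> ?D B - ?X" for q
    unfolding Diff_iff by (cases q) meson
  then have rest: "?D A - ?X = ?D B - ?X"
    by (rule set_eqI)
  have "?D A \<inter> ?X = {(x, y). x \<in> S \<and> y \<in> T \<and> incomparable le x y \<and> x < y}"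
    using sub dis by (auto simp: rowS rowT)
  moreover have "?D B \<inter> ?X = {(y, x). y \<in> T \<and> x \<in> S \<and> incomparable le y x \<and> y < x}"
    using sub dis by (auto simp: rowB_S rowB_T)
  moreover have "\<dots> = prod.swap ` {(x, y). x \<in> S \<and> y \<in> T \<and> incomparable le x y \<and> y < x}"
    by (auto simp: incomparable_def image_iff)
  ultimately have "card (?D A \<inter> ?X) = card (?D B \<inter> ?X)"
    using balanced by (simp add: card_image)
  then have "card (?D A) = card (?D B)"
    unfolding card_Int_Diff[OF finD[of A], of ?X] card_Int_Diff[OF finD[of B], of ?X] rest
    by (rule arg_cong2[OF _ refl])
  then show ?thesis
    by (simp add: asc_def)
qed

text \<open>
  \<open>U'\<close> and \<open>V'\<close> are the elements that stay in rows \<open>r\<close> and \<open>r + 1\<close>. Here \<open>A\<close> is the array that has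
  the string in the upper row, which is the one before a lowering and the one after a raising.
\<close>

lemma (in moving_string) asc_move:
  assumes A: "set (A r) = U' \<union> S" "set (A (Suc r)) = V' \<union> T"
    and B: "set (B r) = U' \<union> T" "set (B (Suc r)) = V' \<union> S"
    and rest: "U' \<union> V' = (U - S) \<union> (V - T)"
    and others: "\<And>i. i \<noteq> r \<Longrightarrow> i \<noteq> Suc r \<Longrightarrow> set (B i) = set (A i) \<and> set (A i) \<inter> (U \<union> V) = {}"
  shows "asc P le A = asc P le B"
proof (rule asc_exchange[OF finite_P A B])
  have T_V: "T \<subseteq> V"
    by (auto simp: T_def)
  show "S \<inter> T = {}" "(S \<union> T) \<inter> (U' \<union> V') = {}"
    using S_U T_V disj unfolding rest by blast+
  show "S \<subseteq> P" "T \<subseteq> P"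
    using S_U T_V U_sub V_sub by auto
  show "set (B i) = set (A i)" "set (A i) \<inter> (S \<union> T) = {}" if "i \<noteq> r" "i \<noteq> Suc r" for i
    using others[OF that] S_U T_V by auto
  have chain: "\<not> x \<parallel> y" if "x \<in> U \<and> y \<in> U \<or> x \<in> V \<and> y \<in> V" for x y
    using that chain_U[of x y] chain_V[of x y] in_P[of x] in_P[of y] by (auto simp: par_iff)
  show "\<not> x \<parallel> y" if "x \<in> S \<union> T" "y \<in> U' \<union> V'" for x y
    using that S_comparable[of x y] T_comparable[of x y] chain[of x y] S_U T_V
    unfolding rest by blast
  show "\<not> x \<parallel> y" if "x \<in> S" "y \<in> S" for x y
    using chain[of x y] that S_U by blast
  show "\<not> x \<parallel> y" if "x \<in> T" "y \<in> T" for x y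
    using chain[of x y] that T_V by blast
qed (rule ascents_balanced)

section \<open>Rows of an array\<close>

lemma col_a_greater:
  assumes "i < length bs \<and> less_P le (bs ! i) (as ! k) \<and> c = Suc i \<or> i < k \<and> c = col_a le as bs i"
  shows "c < col_a le as bs k"
proof -
  have "c \<le> Max (insert 0 ({Suc i | i. i < length bs \<and> less_P le (bs ! i) (as ! k)} \<union>
                    col_a le as bs ` {..<k}))"
    using assms by (intro Max_ge) auto
  then show ?thesis
    by (subst col_a.simps) simp
qed

lemma col_a_cases:
  obtains "col_a le as bs k = 1"
  | i where "i < length bs" "less_P le (bs ! i) (as ! k)" "col_a le as bs k = Suc (Suc i)"
  | i where "i < k" "col_a le as bs k = Suc (col_a le as bs i)"
proof -
  let ?C = "insert 0 ({Suc i | i. i < length bs \<and> less_P le (bs ! i) (as ! k)} \<union>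
                    col_a le as bs ` {..<k})"
  have "Max ?C \<in> ?C"
    by (intro Max_in) auto
  moreover have "col_a le as bs k = Suc (Max ?C)"
    by (subst col_a.simps) simp
  ultimately show thesis
    using that by auto
qed

context unit_interval_order
begin

lemma row_sub: "A \<in> P_arrays P le \<Longrightarrow> set (A i) \<subseteq> P"
  by (auto simp: P_arrays_def)

lemma row_sorted:
  assumes "A \<in> P_arrays P le"
  shows "sorted_wrt prec (A i)"
proof -
  have "transp prec"
    using prec_trans by (intro transpI)
  then show ?thesis
    using assms by (simp add: sorted_wrt_iff_nth_Suc_transp P_arrays_def)
qed

lemma row_distinct:
  assumes "A \<in> P_arrays P le"
  shows "distinct (A i)"
  unfolding distinct_conv_nth
proof (intro allI impI)
  fix j k assume "j < length (A i)" "k < length (A i)" "j \<noteq> k"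
  then show "A i ! j \<noteq> A i ! k"
    using sorted_wrt_nth_less[OF row_sorted[OF assms, of i], of j k]
      sorted_wrt_nth_less[OF row_sorted[OF assms, of i], of k j]
    by (cases "j < k") auto
qed

lemma row_unique:
  assumes A: "A \<in> P_arrays P le" and x: "x \<in> set (A i)" "x \<in> set (A j)"
  shows "i = j"
proof -
  have "\<exists>!(i, j). j < length (A i) \<and> A i ! j = x"
    using A row_sub[OF A, of i] x(1) unfolding P_arrays_def by blast
  moreover obtain k l where "k < length (A i)" "A i ! k = x" "l < length (A j)" "A j ! l = x"
    using x by (auto simp: in_set_conv_nth)
  ultimately show ?thesis
    by blast
qed

lemma row_chain:
  assumes "A \<in> P_arrays P le" "x \<in> set (A i)" "y \<in> set (A i)" "x \<noteq> y"
  shows "x \<prec> y \<or> y \<prec> x"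
proof -
  obtain k l where kl: "k < length (A i)" "A i ! k = x" "l < length (A i)" "A i ! l = y"
    using assms by (auto simp: in_set_conv_nth)
  then have "k < l \<or> l < k"
    using assms(4) by (metis linorder_neqE_nat)
  then show ?thesis
    using kl sorted_wrt_nth_less[OF row_sorted[OF assms(1), of i]] by blast
qed

lemma row_index:
  assumes "A \<in> P_arrays P le" "k < length (A i)"
  shows "index_in (A i) (A i ! k) = k"
  unfolding index_in_def using row_distinct[OF assms(1), of i] assms(2)
  by (intro the_equality) (auto simp: nth_eq_iff_index_eq)

lemma row_less_index:
  assumes "A \<in> P_arrays P le" "k < length (A i)" "l < length (A i)" "A i ! k \<prec> A i ! l"
  shows "k < l"
proof (rule ccontr)
  assume "\<not> k < l"
  then have "k = l \<or> A i ! l \<prec> A i ! k"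
    using sorted_wrt_nth_less[OF row_sorted[OF assms(1), of i], of l k] assms(2) by linarith
  then show False
    using assms(4) prec_trans prec_irrefl by metis
qed

lemma pre_aligned_pre_alignment:
  assumes A: "A \<in> P_arrays P le"
  shows "pre_aligned P le (set (A r)) (set (A (Suc r))) (pre_alignment le r A)"
proof -
  let ?as = "A r" and ?bs = "A (Suc r)" and ?C = "pre_alignment le r A"
  have disj: "set ?as \<inter> set ?bs = {}"
    using row_unique[OF A, of _ r "Suc r"] by auto
  have Ca: "?C (?as ! k) = col_a le ?as ?bs k" if "k < length ?as" for k
    using that row_index[OF A that] by (simp add: pre_alignment_def)
  have Cb: "?C (?bs ! k) = Suc k" if "k < length ?bs" for k
    using that row_index[OF A that] nth_mem[OF that] disj by (auto simp: pre_alignment_def)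
  show ?thesis
  proof unfold_locales
    show "set ?as \<subseteq> P" "set ?bs \<subseteq> P" "set ?as \<inter> set ?bs = {}"
      using row_sub[OF A] disj by auto
  next
    fix x y assume "x \<in> set ?as" "y \<in> set ?as" "x \<noteq> y"
    then show "x \<prec> y \<or> y \<prec> x"
      by (rule row_chain[OF A])
  next
    fix x y assume "x \<in> set ?bs" "y \<in> set ?bs" "x \<noteq> y"
    then show "x \<prec> y \<or> y \<prec> x"
      by (rule row_chain[OF A])
  next
    fix x y assume xy: "x \<in> set ?as" "y \<in> set ?as" "x \<prec> y"
    then obtain k l where kl: "k < length ?as" "x = ?as ! k" "l < length ?as" "y = ?as ! l"
      by (metis in_set_conv_nth)
    then have "k < l"
      using row_less_index[OF A] xy by blast
    then show "?C x < ?C y"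
      using kl Ca col_a_greater[of k ?bs le ?as l] by simp
  next
    fix x y assume xy: "x \<in> set ?bs" "y \<in> set ?bs" "x \<prec> y"
    then obtain k l where kl: "k < length ?bs" "x = ?bs ! k" "l < length ?bs" "y = ?bs ! l"
      by (metis in_set_conv_nth)
    then have "k < l"
      using row_less_index[OF A] xy by blast
    then show "?C x < ?C y"
      using kl Cb by simp
  next
    fix y assume y: "y \<in> set ?as \<union> set ?bs"
    show "?C y = 1 \<or> (\<exists>z\<in>set ?as \<union> set ?bs. z \<prec> y \<and> Suc (?C z) = ?C y)"
    proof (cases "y \<in> set ?as")
      case True
      then obtain k where k: "k < length ?as" "y = ?as ! k"
        by (metis in_set_conv_nth)
      show ?thesis
      proof (cases rule: col_a_cases[of le ?as ?bs k])
        case 1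
        then show ?thesis
          using k Ca by simp
      next
        case (2 i)
        then show ?thesis
          using k Ca[of k] Cb[of i] nth_mem[of i ?bs] by (intro disjI2 bexI[of _ "?bs ! i"]) auto
      next
        case (3 i)
        then have "?as ! i \<prec> y"
          using k sorted_wrt_nth_less[OF row_sorted[OF A]] by blast
        then show ?thesis
          using 3 k Ca[of k] Ca[of i] nth_mem[of i ?as]
          by (intro disjI2 bexI[of _ "?as ! i"]) auto
      qed
    next
      case False
      then obtain k where k: "k < length ?bs" "y = ?bs ! k"
        using y by (metis UnE in_set_conv_nth)
      show ?thesis
      proof (cases k)
        case 0
        then show ?thesis
          using k Cb by simp
      next
        case (Suc i)
        then have "?bs ! i \<prec> y"
          using k sorted_wrt_nth_less[OF row_sorted[OF A]] by blast
        then show ?thesis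
          using Suc k Cb[of k] Cb[of i] nth_mem[of i ?bs]
          by (intro disjI2 bexI[of _ "?bs ! i"]) auto
      qed
    qed
  qed
qed

lemma aligned_rows_alignment:
  assumes A: "A \<in> P_arrays P le"
  shows "aligned_rows P le (set (A r)) (set (A (Suc r))) (alignment le r A)
           {y. alignment le r A y \<noteq> pre_alignment le r A y}"
proof -
  interpret pre_aligned P le "set (A r)" "set (A (Suc r))" "pre_alignment le r A"
    by (rule pre_aligned_pre_alignment[OF A])
  show ?thesis
    using alignment_terminates aligned_rows_stable unfolding alignment_def align_seq_def by blast
qed

lemma asc_lower:
  assumes A: "A \<in> P_arrays P le" and lower: "lower le r A = Some B"
  shows "asc P le A = asc P le B"
proof -
  let ?as = "A r" and ?bs = "A (Suc r)" and ?col = "alignment le r A"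
  define p where "p = (LEAST p. p < length ?as \<and> \<not> (\<exists>b\<in>set ?bs. ?col b = ?col (?as ! p)))"
  define t where "t = (LEAST t. p + t < length ?as \<and>
    \<not> (\<exists>b\<in>set ?bs. \<not> ?as ! (p + t) \<prec> b \<and> ?col b = ?col (?as ! (p + t)) + 1))"
  have ex: "\<not> (\<forall>a\<in>set ?as. \<exists>b\<in>set ?bs. ?col b = ?col a)"
    using lower unfolding lower_def Let_def by (auto split: if_splits)
  then obtain k where "k < length ?as \<and> \<not> (\<exists>b\<in>set ?bs. ?col b = ?col (?as ! k))"
    by (metis in_set_conv_nth)
  then have p: "p < length ?as \<and> \<not> (\<exists>b\<in>set ?bs. ?col b = ?col (?as ! p))"
    unfolding p_def by (rule LeastI)
  interpret aligned_rows P le "set ?as" "set ?bs" ?col "{y. ?col y \<noteq> pre_alignment le r A y}"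
    by (rule aligned_rows_alignment[OF A])
  interpret ms: moving_string P le "set ?as" "set ?bs" ?col
    "{y. ?col y \<noteq> pre_alignment le r A y}" ?as p t
    unfolding t_def by (rule moving_string_LEAST) (use p row_sorted[OF A] in auto)
  have B: "B = A(r := sorted_list_of_set (set ?as - ms.S \<union> ms.T),
              Suc r := sorted_list_of_set (set ?bs - ms.T \<union> ms.S))"
    using lower ex unfolding lower_def Let_def ms.T_def ms.S_def p_def[symmetric] t_def[symmetric]
    by simp
  have fin: "finite ms.S" "finite ms.T" and T: "ms.T \<subseteq> set ?bs"
    using finite_subset[OF ms.S_U] by (auto simp: ms.T_def)
  show ?thesis
  proof (rule ms.asc_move[of A r "set ?as - ms.S" "set ?bs - ms.T" B])
    show "set (B i) = set (A i) \<and> set (A i) \<inter> (set ?as \<union> set ?bs) = {}"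
      if "i \<noteq> r" "i \<noteq> Suc r" for i
      using that row_unique[OF A, of _ i r] row_unique[OF A, of _ i "Suc r"] by (auto simp: B)
  qed (use ms.S_U T fin in \<open>auto simp: B\<close>)
qed

lemma asc_raise:
  assumes A: "A \<in> P_arrays P le" and raise: "raise le r A = Some B"
  shows "asc P le A = asc P le B"
proof -
  let ?as = "A r" and ?bs = "A (Suc r)" and ?col = "alignment le r A"
  define p where "p = (GREATEST p. p < length ?bs \<and> \<not> (\<exists>a\<in>set ?as. ?col a = ?col (?bs ! p)))"
  define t where "t = (LEAST t. p + t < length ?bs \<and>
    \<not> (\<exists>a\<in>set ?as. \<not> ?bs ! (p + t) \<prec> a \<and> ?col a = ?col (?bs ! (p + t)) + 1))"
  have ex: "\<not> (\<forall>b\<in>set ?bs. \<exists>a\<in>set ?as. ?col a = ?col b)"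
    using raise unfolding raise_def Let_def by (auto split: if_splits)
  then obtain k where "k < length ?bs \<and> \<not> (\<exists>a\<in>set ?as. ?col a = ?col (?bs ! k))"
    by (metis in_set_conv_nth)
  then have p: "p < length ?bs \<and> \<not> (\<exists>a\<in>set ?as. ?col a = ?col (?bs ! p))"
    unfolding p_def by (rule GreatestI_nat[where b = "length ?bs"]) auto
  interpret aligned_rows P le "set ?bs" "set ?as" ?col "{y. ?col y \<noteq> pre_alignment le r A y}"
    by (rule aligned_rows.flip[OF aligned_rows_alignment[OF A]])
  interpret ms: moving_string P le "set ?bs" "set ?as" ?col
    "{y. ?col y \<noteq> pre_alignment le r A y}" ?bs p t
    unfolding t_def by (rule moving_string_LEAST) (use p row_sorted[OF A] in auto)
  have B: "B = A(r := sorted_list_of_set (set ?as - ms.T \<union> ms.S),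
              Suc r := sorted_list_of_set (set ?bs - ms.S \<union> ms.T))"
    using raise ex unfolding raise_def Let_def ms.T_def ms.S_def p_def[symmetric] t_def[symmetric]
    by simp
  have fin: "finite ms.S" "finite ms.T" and T: "ms.T \<subseteq> set ?as"
    using finite_subset[OF ms.S_U] by (auto simp: ms.T_def)
  have "asc P le B = asc P le A"
  proof (rule ms.asc_move[of B r "set ?as - ms.T" "set ?bs - ms.S" A])
    show "set (A i) = set (B i) \<and> set (B i) \<inter> (set ?bs \<union> set ?as) = {}"
      if "i \<noteq> r" "i \<noteq> Suc r" for i
      using that row_unique[OF A, of _ i r] row_unique[OF A, of _ i "Suc r"] by (auto simp: B)
  qed (use ms.S_U T fin in \<open>auto simp: B\<close>)
  then show ?thesis
    by simp
qed

lemma asc_crystal_connected: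
  assumes "(A, B) \<in> crystal_connected P le"
  shows "asc P le A = asc P le B"
proof -
  have edge: "asc P le A = asc P le B" if "(A, B) \<in> crystal_edges P le r" for A B r
    using that asc_lower[of A r B] asc_raise[of B r A] unfolding crystal_edges_def by auto
  let ?E = "\<Union>r\<in>{1..}. crystal_edges P le r"
  have "(A, B) \<in> (?E \<union> ?E\<inverse>)\<^sup>*"
    using assms unfolding crystal_connected_def Let_def by blast
  then show ?thesis
  proof (induction rule: rtrancl_induct)
    case (step B C)
    then obtain r where "(B, C) \<in> crystal_edges P le r \<or> (C, B) \<in> crystal_edges P le r"
      by blast
    then have "asc P le B = asc P le C"
      using edge[of B C r] edge[of C B r] by auto
    then show ?case
      using step.IH by simp
  qed simp
qed

end

theorem theorem7p3:
  fixes P :: "nat set" and le :: "nat rel" and K :: "array set"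
  assumes "natural_unit_interval_order P le"
    and "K \<in> crystal_components P le"
    and "A \<in> K" and "B \<in> K"
  shows "asc P le A = asc P le B"
proof -
  interpret unit_interval_order P le
    by unfold_locales (rule assms(1))
  obtain X where "K = crystal_connected P le `` {X}"
    using assms(2) by (auto simp: crystal_components_def elim: quotientE)
  then have "(X, A) \<in> crystal_connected P le" "(X, B) \<in> crystal_connected P le"
    using assms(3,4) by auto
  then show ?thesis
    using asc_crystal_connected by metis
qed

end
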